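(* Let $f,g:\mathcal{C}\to\mathcal{D}$ be two non $1$-contracting $\omega$-functors between $\omega$-categories, and suppose that $f$ and $g$ are homotopic. Then for every natural number $n$, $f$ and $g$ induce linear maps $H_n^{gl}(f),H_n^{gl}(g):H_n^{gl}(\mathcal{C})\to H_n^{gl}(\mathcal{D})$, and moreover $H_n^{gl}(f)=H_n^{gl}(g)$.
   Context: An $\omega$-category is a set $A$ with maps $s_n=d_n^-$ and $t_n=d_n^+$ from $A$ to $A$ ($n\ge 0$) and partial binary operations $*_n$ ($n\ge 0$), where $x*_n y$ is defined exactly when $t_n x=s_n y$, such that for all $\alpha,\beta\in\{-,+\}$: (1) $d_m^\beta d_n^\alpha x=d_m^\beta x$ if $m<n$ and $d_m^\beta d_n^\alpha x=d_n^\alpha x$ if $m\ge n$; (2) $s_nx*_nx=x*_nt_nx=x$; (3) if $x*_ny$ is defined then $s_n(x*_ny)=s_nx$, $t_n(x*_ny)=t_ny$, and $d_m^\alpha(x*_ny)=d_m^\alpha x*_nd_m^\alpha y$ for $m\neq n$; (4) $(x*_ny)*_nz=x*_n(y*_nz)$ when both sides exist; (5) $(x*_ny)*_m(z*_nw)=(x*_mz)*_n(y*_mw)$ for $m\neq n$ when both sides make sense; (6) for every $x$ there is $n$ with $s_nx=t_nx=x$; the least such $n$ is the dimension $\dim(x)$. An $\omega$-functor is a map preserving all $s_n,t_n,*_n$. $\mathcal{C}_n$ denotes the set of $n$-dimensional elements ($n$-morphisms) of $\mathcal{C}$, and $\mathbb{Z}S$ the free abelian group on a set $S$. All maps $s_n,t_n$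 and all $\omega$-functors are extended by linearity. Standing assumption: in the $\omega$-categories considered, $s_nx$ and $t_nx$ are $n$-dimensional whenever $x$ is $(n+1)$-dimensional ($n\ge0$). An $\omega$-functor $f:\mathcal{C}\to\mathcal{D}$ is non $1$-contracting if $f(x)$ is $1$-dimensional for every $1$-dimensional $x$. Globular homology: $C_0^{gl}(\mathcal{C})=\mathbb{Z}\mathcal{C}_0\oplus\mathbb{Z}\mathcal{C}_0$, $C_n^{gl}(\mathcal{C})=\mathbb{Z}\mathcal{C}_n$ for $n\ge1$; $\partial^{gl}(x)=(s_0x,t_0x)$ for $x\in\mathbb{Z}\mathcal{C}_1$, and $\partial^{gl}(x)=s_nx-t_nx$ for $x\in\mathbb{Z}\mathcal{C}_{n+1}$, $n\ge1$. $H_n^{gl}(\mathcal{C})$ is the $n$-th homology of this chain complex. A non $1$-contracting $\omega$-functor $f$ acts on it by $f\oplus f$ in degree $0$, and in degree $n\ge1$ by the linear map sending $x\in\mathcal{C}_n$ to $f(x)$ if $\dim f(x)=n$ and to $0$ otherwise. Homotopy: two non $1$-contracting $\omega$-functors $f,g:\mathcal{C}\to\mathcal{D}$ are homotopic if (i) $f(x)=g(x)$ for every $0$-dimensional $x$; (ii) there is a linear map $h_1:\mathbb{Z}\mathcal{C}_1\to\mathbb{Z}\mathcal{D}_2$ with $(s_1-t_1)h_1(x)=f(x)-g(x)$ for every $1$-morphism $x$; (iii) for every $n\ge2$ there is a linear map $h_n:\mathbb{Z}\mathcal{C}_n\to\mathbb{Z}\mathcal{D}_{n+1}$ such that for every $n$-morphism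 $x$, $h_{n-1}(s_{n-1}-t_{n-1})(x)+(s_n-t_n)h_n(x)=f(x)-g(x)$ modulo morphisms of dimension $\le n-1$ (that is, as an equality in $\mathbb{Z}\mathcal{D}_n$ where terms of $f(x),g(x)$ of dimension $<n$ are replaced by $0$). *)

theory Defs
  imports "HOL-Algebra.Free_Abelian_Groups"
begin

section \<open>Omega-categories\<close>

datatype sign = Minus | Plus

text \<open>\<open>face C Minus n\<close> and \<open>face C Plus n\<close> are the maps \<open>s_n\<close> and \<open>t_n\<close>. The partial operation
  \<open>*_n\<close> is a total HOL function whose values are only meaningful on composable pairs of elements of
  the carrier.\<close>

record 'a omega_cat = "'a partial_object" +
  face :: "sign \<Rightarrow> nat \<Rightarrow> 'a \<Rightarrow> 'a"
  ocomp :: "nat \<Rightarrow> 'a \<Rightarrow> 'a \<Rightarrow> 'a"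

abbreviation src :: "'a omega_cat \<Rightarrow> nat \<Rightarrow> 'a \<Rightarrow> 'a"
  where "src C \<equiv> face C Minus"

abbreviation tgt :: "'a omega_cat \<Rightarrow> nat \<Rightarrow> 'a \<Rightarrow> 'a"
  where "tgt C \<equiv> face C Plus"

definition composable :: "'a omega_cat \<Rightarrow> nat \<Rightarrow> 'a \<Rightarrow> 'a \<Rightarrow> bool"
  where "composable C n x y \<longleftrightarrow> x \<in> carrier C \<and> y \<in> carrier C \<and> tgt C n x = src C n y"

locale omega_category =
  fixes C :: "'a omega_cat"
  assumes face_closed: "x \<in> carrier C \<Longrightarrow> face C \<alpha> n x \<in> carrier C"
    and comp_closed: "composable C n x y \<Longrightarrow> ocomp C n x y \<in> carrier C"
    and face_face_less:
      "\<lbrakk>x \<in> carrier C; m < n\<rbrakk> \<Longrightarrow> face C \<beta> m (face C \<alpha> n x) = face C \<beta> m x"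
    and face_face_ge:
      "\<lbrakk>x \<in> carrier C; m \<ge> n\<rbrakk> \<Longrightarrow> face C \<beta> m (face C \<alpha> n x) = face C \<alpha> n x"
    and comp_src_left: "x \<in> carrier C \<Longrightarrow> ocomp C n (src C n x) x = x"
    and comp_tgt_right: "x \<in> carrier C \<Longrightarrow> ocomp C n x (tgt C n x) = x"
    and src_comp: "composable C n x y \<Longrightarrow> src C n (ocomp C n x y) = src C n x"
    and tgt_comp: "composable C n x y \<Longrightarrow> tgt C n (ocomp C n x y) = tgt C n y"
    and face_comp:
      "\<lbrakk>composable C n x y; m \<noteq> n\<rbrakk>
        \<Longrightarrow> composable C n (face C \<alpha> m x) (face C \<alpha> m y)
          \<and> face C \<alpha> m (ocomp C n x y) = ocomp C n (face C \<alpha> m x) (face C \<alpha> m y)"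
    and comp_assoc:
      "\<lbrakk>composable C n x y; composable C n (ocomp C n x y) z;
        composable C n y z; composable C n x (ocomp C n y z)\<rbrakk>
        \<Longrightarrow> ocomp C n (ocomp C n x y) z = ocomp C n x (ocomp C n y z)"
    and interchange:
      "\<lbrakk>m \<noteq> n; composable C n x y; composable C n z w;
        composable C m (ocomp C n x y) (ocomp C n z w);
        composable C m x z; composable C m y w;
        composable C n (ocomp C m x z) (ocomp C m y w)\<rbrakk>
        \<Longrightarrow> ocomp C m (ocomp C n x y) (ocomp C n z w)
          = ocomp C n (ocomp C m x z) (ocomp C m y w)"
    and finite_dim: "x \<in> carrier C \<Longrightarrow> \<exists>n. src C n x = x \<and> tgt C n x = x"

definition odim :: "'a omega_cat \<Rightarrow> 'a \<Rightarrow> nat"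
  where "odim C x = (LEAST n. src C n x = x \<and> tgt C n x = x)"

definition cells :: "'a omega_cat \<Rightarrow> nat \<Rightarrow> 'a set"
  where "cells C n = {x \<in> carrier C. odim C x = n}"

definition dim_regular :: "'a omega_cat \<Rightarrow> bool"
  where "dim_regular C \<longleftrightarrow>
    (\<forall>n. \<forall>x \<in> cells C (Suc n). src C n x \<in> cells C n \<and> tgt C n x \<in> cells C n)"

definition omega_functor :: "'a omega_cat \<Rightarrow> 'b omega_cat \<Rightarrow> ('a \<Rightarrow> 'b) \<Rightarrow> bool"
  where "omega_functor C D f \<longleftrightarrow>
    (\<forall>x \<in> carrier C. f x \<in> carrier D) \<and>
    (\<forall>x \<in> carrier C. \<forall>\<alpha> n. f (face C \<alpha> n x) = face D \<alpha> n (f x)) \<and>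
    (\<forall>n x y. composable C n x y \<longrightarrow> f (ocomp C n x y) = ocomp D n (f x) (f y))"

definition non_1_contracting :: "'a omega_cat \<Rightarrow> 'b omega_cat \<Rightarrow> ('a \<Rightarrow> 'b) \<Rightarrow> bool"
  where "non_1_contracting C D f \<longleftrightarrow> (\<forall>x \<in> cells C 1. f x \<in> cells D 1)"


section \<open>Globular homology\<close>

abbreviation cell_group :: "'a omega_cat \<Rightarrow> nat \<Rightarrow> ('a \<Rightarrow>\<^sub>0 int) monoid"
  where "cell_group C n \<equiv> free_Abelian_group (cells C n)"

definition linearize :: "('a \<Rightarrow> 'b) \<Rightarrow> ('a \<Rightarrow>\<^sub>0 int) \<Rightarrow> ('b \<Rightarrow>\<^sub>0 int)"
  where "linearize \<phi> = frag_extend (\<lambda>x. frag_of (\<phi> x))"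

definition src_minus_tgt :: "'a omega_cat \<Rightarrow> nat \<Rightarrow> ('a \<Rightarrow>\<^sub>0 int) \<Rightarrow> ('a \<Rightarrow>\<^sub>0 int)"
  where "src_minus_tgt C n c = linearize (src C n) c - linearize (tgt C n) c"

text \<open>To have one HOL type for all degrees, the chain group of degree \<open>n \<ge> 1\<close> is represented as the
  direct product of the free abelian group on the \<open>n\<close>-cells with the trivial group
  \<open>free_Abelian_group {}\<close>.\<close>

definition gl_chain :: "'a omega_cat \<Rightarrow> nat \<Rightarrow> (('a \<Rightarrow>\<^sub>0 int) \<times> ('a \<Rightarrow>\<^sub>0 int)) monoid"
  where "gl_chain C n =
    (if n = 0 then cell_group C 0 \<times>\<times> cell_group C 0
     else cell_group C n \<times>\<times> free_Abelian_group {})"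

text \<open>\<open>gl_boundary C n\<close> is the boundary map from degree \<open>n + 1\<close> to degree \<open>n\<close>.\<close>

definition gl_boundary ::
    "'a omega_cat \<Rightarrow> nat \<Rightarrow> ('a \<Rightarrow>\<^sub>0 int) \<times> ('a \<Rightarrow>\<^sub>0 int) \<Rightarrow> ('a \<Rightarrow>\<^sub>0 int) \<times> ('a \<Rightarrow>\<^sub>0 int)"
  where "gl_boundary C n c =
    (if n = 0 then (linearize (src C 0) (fst c), linearize (tgt C 0) (fst c))
     else (src_minus_tgt C n (fst c), 0))"

fun gl_cycles :: "'a omega_cat \<Rightarrow> nat \<Rightarrow> (('a \<Rightarrow>\<^sub>0 int) \<times> ('a \<Rightarrow>\<^sub>0 int)) set"
  where
    "gl_cycles C 0 = carrier (gl_chain C 0)"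
  | "gl_cycles C (Suc n) = kernel (gl_chain C (Suc n)) (gl_chain C n) (gl_boundary C n)"

definition gl_boundaries :: "'a omega_cat \<Rightarrow> nat \<Rightarrow> (('a \<Rightarrow>\<^sub>0 int) \<times> ('a \<Rightarrow>\<^sub>0 int)) set"
  where "gl_boundaries C n = gl_boundary C n ` carrier (gl_chain C (Suc n))"

definition gl_cycle_group :: "'a omega_cat \<Rightarrow> nat \<Rightarrow> (('a \<Rightarrow>\<^sub>0 int) \<times> ('a \<Rightarrow>\<^sub>0 int)) monoid"
  where "gl_cycle_group C n = (gl_chain C n) \<lparr>carrier := gl_cycles C n\<rparr>"

definition gl_homology :: "'a omega_cat \<Rightarrow> nat \<Rightarrow> (('a \<Rightarrow>\<^sub>0 int) \<times> ('a \<Rightarrow>\<^sub>0 int)) set monoid"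
  where "gl_homology C n = gl_cycle_group C n Mod gl_boundaries C n"

definition gl_class ::
    "'a omega_cat \<Rightarrow> nat \<Rightarrow> ('a \<Rightarrow>\<^sub>0 int) \<times> ('a \<Rightarrow>\<^sub>0 int) \<Rightarrow> (('a \<Rightarrow>\<^sub>0 int) \<times> ('a \<Rightarrow>\<^sub>0 int)) set"
  where "gl_class C n z = gl_boundaries C n #>\<^bsub>gl_cycle_group C n\<^esub> z"


section \<open>The action of functors on globular homology\<close>

text \<open>\<open>trunc D n f x\<close> is \<open>f x\<close> modulo morphisms of dimension different from \<open>n\<close>. An omega-functor
  does not raise dimensions, so on an \<open>n\<close>-cell \<open>x\<close> only dimensions below \<open>n\<close> are discarded.\<close>

definition trunc :: "'b omega_cat \<Rightarrow> nat \<Rightarrow> ('a \<Rightarrow> 'b) \<Rightarrow> 'a \<Rightarrow> ('b \<Rightarrow>\<^sub>0 int)"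
  where "trunc D n f x = (if odim D (f x) = n then frag_of (f x) else 0)"

definition gl_chain_map ::
    "'b omega_cat \<Rightarrow> ('a \<Rightarrow> 'b) \<Rightarrow> nat \<Rightarrow> ('a \<Rightarrow>\<^sub>0 int) \<times> ('a \<Rightarrow>\<^sub>0 int) \<Rightarrow> ('b \<Rightarrow>\<^sub>0 int) \<times> ('b \<Rightarrow>\<^sub>0 int)"
  where "gl_chain_map D f n c =
    (if n = 0 then (linearize f (fst c), linearize f (snd c))
     else (frag_extend (trunc D n f) (fst c), 0))"

definition gl_induces ::
    "'a omega_cat \<Rightarrow> 'b omega_cat \<Rightarrow> ('a \<Rightarrow> 'b) \<Rightarrow> nat \<Rightarrow>
      ((('a \<Rightarrow>\<^sub>0 int) \<times> ('a \<Rightarrow>\<^sub>0 int)) set \<Rightarrow> (('b \<Rightarrow>\<^sub>0 int) \<times> ('b \<Rightarrow>\<^sub>0 int)) set) \<Rightarrow> bool"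
  where "gl_induces C D f n \<Phi> \<longleftrightarrow>
    \<Phi> \<in> hom (gl_homology C n) (gl_homology D n) \<and>
    (\<forall>z \<in> gl_cycles C n. gl_chain_map D f n z \<in> gl_cycles D n \<and>
       \<Phi> (gl_class C n z) = gl_class D n (gl_chain_map D f n z))"

text \<open>\<open>H_n(f)\<close> sends a homology class \<open>X\<close> to the common class of the images of its representatives.
  That these images do have a common class is not built in: the value is unspecified otherwise, and
  it is part of \<^const>\<open>gl_induces\<close>. Outside the homology group the function is
  \<^const>\<open>undefined\<close>, so that equality of functions is equality of maps on homology.\<close>

definition gl_homology_map ::
    "'a omega_cat \<Rightarrow> 'b omega_cat \<Rightarrow> ('a \<Rightarrow> 'b) \<Rightarrow> nat \<Rightarrow>
      (('a \<Rightarrow>\<^sub>0 int) \<times> ('a \<Rightarrow>\<^sub>0 int)) set \<Rightarrow> (('b \<Rightarrow>\<^sub>0 int) \<times> ('b \<Rightarrow>\<^sub>0 int)) set"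
  where "gl_homology_map C D f n =
    (\<lambda>X \<in> carrier (gl_homology C n).
       the_elem ((\<lambda>z. gl_class D n (gl_chain_map D f n z)) ` X))"


section \<open>Homotopy\<close>

definition gl_homotopic :: "'a omega_cat \<Rightarrow> 'b omega_cat \<Rightarrow> ('a \<Rightarrow> 'b) \<Rightarrow> ('a \<Rightarrow> 'b) \<Rightarrow> bool"
  where "gl_homotopic C D f g \<longleftrightarrow>
    (\<forall>x \<in> cells C 0. f x = g x) \<and>
    (\<exists>h. (\<forall>n \<ge> 1. h n \<in> hom (cell_group C n) (cell_group D (n + 1))) \<and>
      (\<forall>x \<in> cells C 1. src_minus_tgt D 1 (h 1 (frag_of x)) = frag_of (f x) - frag_of (g x)) \<and>
      (\<forall>n \<ge> 2. \<forall>x \<in> cells C n.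
         h (n - 1) (src_minus_tgt C (n - 1) (frag_of x)) + src_minus_tgt D n (h n (frag_of x))
           = trunc D n f x - trunc D n g x))"

end

theory Submission
  imports Defs "HOL-Library.Product_Plus"
begin

text \<open>A functor commutes with the boundary even though truncation kills collapsed cells, because the
  two faces of a collapsed cell have the same image; in degree \<open>1\<close> non-contraction is needed, since
  there the two faces are recorded separately and cannot cancel. For homotopic functors, the term
  \<open>h_{n-1} (s_{n-1} - t_{n-1})\<close> vanishes on \<open>n\<close>-cycles, so that \<open>f z - g z\<close> is the boundary of
  \<open>h_n z\<close>; in degree \<open>0\<close> the two chain maps coincide.\<close>

section \<open>Homomorphisms of quotient groups\<close>

text \<open>The composite of \<open>\<phi>\<close> with the projection to \<open>H Mod M\<close>
  kills \<open>N\<close>, so it factors through \<open>G Mod N\<close> by a homomorphism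
  \<open>\<Psi>\<close>. All elements of a coset \<open>X\<close> are then sent to the single value
  \<open>\<Psi> X\<close>, which is what gives \<open>the_elem\<close> a meaning and makes
  \<open>\<Phi>\<close> agree with \<open>\<Psi>\<close>.\<close>

lemma the_elem_factor_map:
  assumes "group G" and "group H" and "N \<lhd> G" and "M \<lhd> H"
    and "\<phi> \<in> hom G H" and "\<phi> ` N \<subseteq> M"
  defines "\<Phi> \<equiv> \<lambda>X \<in> carrier (G Mod N). the_elem ((\<lambda>z. M #>\<^bsub>H\<^esub> \<phi> z) ` X)"
  shows "\<Phi> \<in> hom (G Mod N) (H Mod M)"
    and "\<And>z. z \<in> carrier G \<Longrightarrow> \<Phi> (N #>\<^bsub>G\<^esub> z) = M #>\<^bsub>H\<^esub> \<phi> z"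
proof -
  interpret G: group G by fact
  interpret H: group H by fact
  interpret N: normal N G by fact
  interpret M: normal M H by fact
  have "(\<lambda>z. M #>\<^bsub>H\<^esub> \<phi> z) \<in> hom G (H Mod M)"
    using hom_compose[OF assms(5) M.r_coset_hom_Mod] by (simp add: comp_def)
  then interpret q: group_hom G "H Mod M" "\<lambda>z. M #>\<^bsub>H\<^esub> \<phi> z"
    by (intro group_hom.intro group_hom_axioms.intro assms(1) M.factorgroup_is_group)
  have "N \<subseteq> kernel G (H Mod M) (\<lambda>z. M #>\<^bsub>H\<^esub> \<phi> z)"
    using assms(6) N.subset M.subset by (auto simp: kernel_def H.coset_join2 M.is_subgroup)
  then obtain \<Psi> where \<Psi>: "\<Psi> \<in> hom (G Mod N) (H Mod M)"
      "\<And>x. x \<in> carrier G \<Longrightarrow> \<Psi> (N #>\<^bsub>G\<^esub> x) = M #>\<^bsub>H\<^esub> \<phi> x"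
    using q.FactGroup_universal_kernel[OF assms(3)] by metis
  have eq: "\<Phi> X = \<Psi> X" if X: "X \<in> carrier (G Mod N)" for X
  proof -
    obtain x where x: "x \<in> carrier G" "X = N #>\<^bsub>G\<^esub> x"
      using X by (auto simp: carrier_FactGroup)
    have "M #>\<^bsub>H\<^esub> \<phi> z = \<Psi> X" if "z \<in> X" for z
      using that x \<Psi>(2) G.repr_independence[OF _ x(1) N.is_subgroup]
        N.elemrcos_carrier[OF assms(1) x(1)] by metis
    moreover have "x \<in> X"
      using x G.rcos_self N.is_subgroup by blast
    ultimately have "(\<lambda>z. M #>\<^bsub>H\<^esub> \<phi> z) ` X = {\<Psi> X}"
      by auto
    then show ?thesis
      using X by (simp add: \<Phi>_def)
  qed
  interpret Q: group "G Mod N"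
    by (rule N.factorgroup_is_group)
  show "\<Phi> \<in> hom (G Mod N) (H Mod M)"
    using \<Psi>(1) eq Q.m_closed by (simp add: hom_def Pi_iff del: mult_FactGroup)
  show "\<Phi> (N #>\<^bsub>G\<^esub> z) = M #>\<^bsub>H\<^esub> \<phi> z" if "z \<in> carrier G" for z
    using that \<Psi>(2) eq by (simp add: carrier_FactGroup)
qed


section \<open>Faces and functors\<close>

context omega_category
begin

text \<open>By \<open>finite_dim\<close> the least level is attained, so \<open>x\<close> is its own
  source at level \<open>odim C x\<close>; any face of that source at the same or a higher level
  returns it unchanged.\<close>

lemma face_eq_self:
  assumes "x \<in> carrier C" and "odim C x \<le> n"
  shows "face C \<alpha> n x = x"
proof -
  have "src C (odim C x) x = x"
    unfolding odim_def using LeastI_ex[OF finite_dim[OF assms(1)]] by blast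
  then show ?thesis
    using face_face_ge[OF assms, of \<alpha> Minus] by simp
qed

lemma odim_le:
  assumes "\<And>\<alpha>. face C \<alpha> n x = x"
  shows "odim C x \<le> n"
  unfolding odim_def by (rule Least_le) (simp add: assms)

end

lemma face_in_cells:
  assumes "dim_regular C" and "x \<in> cells C (Suc n)"
  shows "face C \<alpha> n x \<in> cells C n"
  using assms by (cases \<alpha>) (auto simp: dim_regular_def)

lemma omega_functor_face:
  assumes "omega_functor C D f" and "x \<in> carrier C"
  shows "f (face C \<alpha> n x) = face D \<alpha> n (f x)"
  using assms by (simp add: omega_functor_def)

lemma omega_functor_closed:
  assumes "omega_functor C D f" and "x \<in> carrier C"
  shows "f x \<in> carrier D"
  using assms by (simp add: omega_functor_def)

text \<open>A cell is fixed by both faces at the level of its dimension, and a functor carries this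
  over to the image.\<close>

lemma odim_omega_functor_le:
  assumes "omega_category C" and "omega_category D" and "omega_functor C D f" and "x \<in> carrier C"
  shows "odim D (f x) \<le> odim C x"
proof (rule omega_category.odim_le[OF assms(2)])
  fix \<alpha>
  show "face D \<alpha> (odim C x) (f x) = f x"
    using omega_functor_face[OF assms(3,4)] omega_category.face_eq_self[OF assms(1,4)]
    by (metis order_refl)
qed


section \<open>The globular chain complex\<close>

text \<open>This induction extends linear identities from single cells to chains: the case
  \<open>frag_of\<close> holds the geometry, the other two are linearity.\<close>

lemmas cell_group_induct = free_Abelian_group_induct [consumes 1, case_names zero diff frag_of]

section \<open>Linear extensions of the face maps and their supports\<close>

lemma linearize_of [simp]: "linearize \<phi> (frag_of x) = frag_of (\<phi> x)"
  by (simp add: linearize_def)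

lemma linearize_0 [simp]: "linearize \<phi> 0 = 0"
  by (simp add: linearize_def)

lemma linearize_add: "linearize \<phi> (a + b) = linearize \<phi> a + linearize \<phi> b"
  by (simp add: linearize_def frag_extend_add)

lemma linearize_diff: "linearize \<phi> (a - b) = linearize \<phi> a - linearize \<phi> b"
  by (simp add: linearize_def frag_extend_diff)

lemma keys_linearize: "Poly_Mapping.keys (linearize \<phi> c) \<subseteq> \<phi> ` Poly_Mapping.keys c"
  using keys_frag_extend[of "\<lambda>x. frag_of (\<phi> x)" c] by (auto simp: linearize_def)

lemma src_minus_tgt_0 [simp]: "src_minus_tgt C n 0 = 0"
  by (simp add: src_minus_tgt_def)

lemma src_minus_tgt_add: "src_minus_tgt C n (a + b) = src_minus_tgt C n a + src_minus_tgt C n b"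
  by (simp add: src_minus_tgt_def linearize_add)

lemma src_minus_tgt_diff: "src_minus_tgt C n (a - b) = src_minus_tgt C n a - src_minus_tgt C n b"
  by (simp add: src_minus_tgt_def linearize_diff)

text \<open>The axioms alone bound the dimension of a face at level \<open>n\<close> by
  \<open>n\<close>; \<open>dim_regular\<close> makes it exactly \<open>n\<close>, so that the
  boundary lands in the right chain group.\<close>

lemma keys_linearize_face:
  assumes "dim_regular C" and "Poly_Mapping.keys c \<subseteq> cells C (Suc n)"
  shows "Poly_Mapping.keys (linearize (face C \<alpha> n) c) \<subseteq> cells C n"
  using keys_linearize[of "face C \<alpha> n" c] face_in_cells[OF assms(1)] assms(2) by blast

lemma keys_src_minus_tgt:
  assumes "dim_regular C" and "Poly_Mapping.keys c \<subseteq> cells C (Suc n)"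
  shows "Poly_Mapping.keys (src_minus_tgt C n c) \<subseteq> cells C n"
  unfolding src_minus_tgt_def
  using keys_diff keys_linearize_face[OF assms] by (metis (no_types) Un_least order_trans)

lemma keys_trunc:
  assumes "omega_functor C D f" and "Poly_Mapping.keys c \<subseteq> carrier C"
  shows "Poly_Mapping.keys (frag_extend (trunc D n f) c) \<subseteq> cells D n"
  using keys_frag_extend[of "trunc D n f" c] assms
  by (fastforce simp: trunc_def cells_def omega_functor_def split: if_splits)

lemma cells_subset_carrier: "cells C n \<subseteq> carrier C"
  by (auto simp: cells_def)

section \<open>Chain groups and the boundary operator\<close>

lemma gl_chain_iff:
  "c \<in> carrier (gl_chain C n) \<longleftrightarrow>
    Poly_Mapping.keys (fst c) \<subseteq> cells C n \<and>
    (if n = 0 then Poly_Mapping.keys (snd c) \<subseteq> cells C n else snd c = 0)"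
  by (cases c) (auto simp: gl_chain_def)

lemma mult_gl_chain [simp]: "x \<otimes>\<^bsub>gl_chain C n\<^esub> y = x + y"
  by (simp add: gl_chain_def mult_DirProd' plus_prod_def)

lemma one_gl_chain [simp]: "\<one>\<^bsub>gl_chain C n\<^esub> = 0"
  by (simp add: gl_chain_def zero_prod_def)

lemma group_gl_chain: "group (gl_chain C n)"
  by (simp add: gl_chain_def DirProd_group)

lemma gl_boundary_add: "gl_boundary C n (x + y) = gl_boundary C n x + gl_boundary C n y"
  by (simp add: gl_boundary_def linearize_add src_minus_tgt_add)

lemma gl_boundary_closed:
  assumes "dim_regular C" and "c \<in> carrier (gl_chain C (Suc n))"
  shows "gl_boundary C n c \<in> carrier (gl_chain C n)"
  using assms keys_linearize_face[OF assms(1)] keys_src_minus_tgt[OF assms(1)]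
  by (auto simp: gl_chain_iff gl_boundary_def)

lemma group_hom_gl_boundary:
  assumes "dim_regular C"
  shows "group_hom (gl_chain C (Suc n)) (gl_chain C n) (gl_boundary C n)"
  by (intro group_hom.intro group_hom_axioms.intro group_gl_chain homI)
    (simp_all add: gl_boundary_closed[OF assms] gl_boundary_add)

text \<open>Globularity: below level \<open>n\<close>, the source and the target at level
  \<open>n\<close> of a cell have the same faces, so the two terms cancel.\<close>

lemma linearize_face_src_minus_tgt:
  assumes "omega_category C" and "m < n" and "Poly_Mapping.keys c \<subseteq> carrier C"
  shows "linearize (face C \<alpha> m) (src_minus_tgt C n c) = 0"
  using assms(3)
  by (induction c rule: cell_group_induct)
    (simp_all add: src_minus_tgt_diff linearize_diff src_minus_tgt_def
      omega_category.face_face_less[OF assms(1) _ assms(2)])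

text \<open>Each face at level \<open>n\<close> kills \<open>src_minus_tgt C (Suc n)\<close>
  separately. This settles both shapes of the boundary: the pair of faces for \<open>n = 0\<close>
  and their difference for larger \<open>n\<close>.\<close>

lemma gl_boundary_boundary:
  assumes "omega_category C" and "c \<in> carrier (gl_chain C (Suc (Suc n)))"
  shows "gl_boundary C n (gl_boundary C (Suc n) c) = 0"
proof -
  have "Poly_Mapping.keys (fst c) \<subseteq> carrier C"
    using assms(2) cells_subset_carrier by (fastforce simp: gl_chain_iff)
  then show ?thesis
    using linearize_face_src_minus_tgt[OF assms(1), of n "Suc n" "fst c"]
    by (auto simp: gl_boundary_def zero_prod_def src_minus_tgt_def[of C n])
qed

section \<open>Cycles, boundaries and the groups behind the homology quotient\<close>

lemma gl_cycles_subset: "gl_cycles C n \<subseteq> carrier (gl_chain C n)"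
  by (cases n) (auto simp: kernel_def)

lemma subgroup_gl_cycles:
  assumes "dim_regular C"
  shows "subgroup (gl_cycles C n) (gl_chain C n)"
  by (cases n)
    (simp_all add: group.subgroup_self group_gl_chain
      group_hom.subgroup_kernel group_hom_gl_boundary[OF assms])

lemma gl_boundaries_subset_cycles:
  assumes "omega_category C" and "dim_regular C"
  shows "gl_boundaries C n \<subseteq> gl_cycles C n"
proof
  fix b assume "b \<in> gl_boundaries C n"
  then obtain c where c: "c \<in> carrier (gl_chain C (Suc n))" "b = gl_boundary C n c"
    by (auto simp: gl_boundaries_def)
  then show "b \<in> gl_cycles C n"
    using gl_boundary_closed[OF assms(2) c(1)] gl_boundary_boundary[OF assms(1)]
    by (cases n) (auto simp: kernel_def)
qed

lemma group_gl_cycle_group: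
  assumes "dim_regular C"
  shows "group (gl_cycle_group C n)"
  unfolding gl_cycle_group_def
  using subgroup.subgroup_is_group[OF subgroup_gl_cycles[OF assms] group_gl_chain] .

lemma normal_gl_boundaries:
  assumes "omega_category C" and "dim_regular C"
  shows "gl_boundaries C n \<lhd> gl_cycle_group C n"
proof -
  have "subgroup (gl_boundaries C n) (gl_chain C n)"
    unfolding gl_boundaries_def by (rule group_hom.img_is_subgroup[OF group_hom_gl_boundary[OF assms(2)]])
  then have "subgroup (gl_boundaries C n) (gl_cycle_group C n)"
    unfolding gl_cycle_group_def
    by (intro group.subgroup_incl[OF group_gl_chain] subgroup_gl_cycles assms
        gl_boundaries_subset_cycles)
  moreover have "comm_group (gl_cycle_group C n)"
    by (rule group.group_comm_groupI[OF group_gl_cycle_group[OF assms(2)]])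
      (simp add: gl_cycle_group_def add.commute)
  ultimately show ?thesis
    by (rule comm_group.subgroup_imp_normal[rotated])
qed


section \<open>Chain maps\<close>

text \<open>On a cell \<open>x\<close> there are two cases. If \<open>f x\<close> keeps dimension
  \<open>n + 1\<close>, then by \<open>dim_regular D\<close> its faces have dimension exactly
  \<open>n\<close> and truncation loses nothing. If the dimension drops, both sides vanish.\<close>

lemma trunc_src_minus_tgt:
  assumes "omega_category C" and "omega_category D" and "dim_regular D" and "omega_functor C D f"
    and "Poly_Mapping.keys c \<subseteq> cells C (Suc n)"
  shows "frag_extend (trunc D n f) (src_minus_tgt C n c)
    = src_minus_tgt D n (frag_extend (trunc D (Suc n) f) c)"
  using assms(5)
proof (induction c rule: cell_group_induct)
  case (frag_of x)
  then have x: "x \<in> carrier C" "odim C x = Suc n"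
    by (auto simp: cells_def)
  have fx: "f x \<in> carrier D"
    using omega_functor_closed[OF assms(4) x(1)] .
  have ff: "f (face C \<alpha> n x) = face D \<alpha> n (f x)" for \<alpha>
    using omega_functor_face[OF assms(4) x(1)] .
  show ?case
  proof (cases "odim D (f x) = Suc n")
    case True
    then have "face D \<alpha> n (f x) \<in> cells D n" for \<alpha>
      using face_in_cells[OF assms(3)] fx by (simp add: cells_def)
    then show ?thesis
      using True by (simp add: src_minus_tgt_def frag_extend_diff trunc_def ff cells_def)
  next
    case False
    \<comment> \<open>Here \<open>f x\<close> may still have dimension \<open>n\<close> and survive
      truncation on the left, but both of its faces are \<open>f x\<close> itself, so their
      difference is zero.\<close>
    then have "odim D (f x) \<le> n"
      using odim_omega_functor_le[OF assms(1,2,4) x(1)] x(2) by simp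
    then have "face D \<alpha> n (f x) = f x" for \<alpha>
      using omega_category.face_eq_self[OF assms(2) fx] by blast
    then show ?thesis
      using False by (simp add: src_minus_tgt_def frag_extend_diff trunc_def ff)
  qed
qed (simp_all add: src_minus_tgt_diff frag_extend_diff)

text \<open>This is needed for each sign separately, without any cancellation; non-contraction
  ensures that truncation in degree 1 discards no cell.\<close>

lemma linearize_face_trunc:
  assumes "omega_functor C D f" and "non_1_contracting C D f"
    and "Poly_Mapping.keys c \<subseteq> cells C 1"
  shows "linearize f (linearize (face C \<alpha> 0) c)
    = linearize (face D \<alpha> 0) (frag_extend (trunc D 1 f) c)"
  using assms(3)
proof (induction c rule: cell_group_induct)
  case (frag_of x)
  then have "f x \<in> cells D 1" "x \<in> carrier C"
    using assms(2) by (auto simp: non_1_contracting_def cells_def)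
  then show ?case
    using omega_functor_face[OF assms(1)] by (simp add: trunc_def cells_def)
qed (simp_all add: linearize_diff frag_extend_diff)

lemma gl_chain_map_add: "gl_chain_map D f n (x + y) = gl_chain_map D f n x + gl_chain_map D f n y"
  by (simp add: gl_chain_map_def linearize_add frag_extend_add)

lemma gl_chain_map_0 [simp]: "gl_chain_map D f n 0 = 0"
  by (simp add: gl_chain_map_def zero_prod_def)

lemma gl_chain_map_closed:
  assumes "omega_category C" and "omega_category D" and "omega_functor C D f"
    and "c \<in> carrier (gl_chain C n)"
  shows "gl_chain_map D f n c \<in> carrier (gl_chain D n)"
proof -
  \<comment> \<open>Degree 0 uses \<open>linearize\<close> without truncation, so the image must
    consist of 0-cells by itself; it does because dimensions cannot rise.\<close>
  have "f x \<in> cells D 0" if "x \<in> cells C 0" for x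
    using that omega_functor_closed[OF assms(3)] odim_omega_functor_le[OF assms(1-3)]
    by (fastforce simp: cells_def)
  then have "Poly_Mapping.keys (linearize f d) \<subseteq> cells D 0"
    if "Poly_Mapping.keys d \<subseteq> cells C 0" for d
    using keys_linearize[of f d] that by blast
  moreover have "Poly_Mapping.keys (frag_extend (trunc D n f) (fst c)) \<subseteq> cells D n"
    using keys_trunc[OF assms(3)] assms(4) cells_subset_carrier
    by (metis gl_chain_iff order_trans)
  ultimately show ?thesis
    using assms(4) by (simp add: gl_chain_iff gl_chain_map_def split: if_split_asm)
qed

lemma gl_chain_map_boundary:
  assumes "omega_category C" and "omega_category D" and "dim_regular D"
    and "omega_functor C D f" and "non_1_contracting C D f"
    and "c \<in> carrier (gl_chain C (Suc n))"
  shows "gl_chain_map D f n (gl_boundary C n c) = gl_boundary D n (gl_chain_map D f (Suc n) c)"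
  using assms(6) trunc_src_minus_tgt[OF assms(1-4)] linearize_face_trunc[OF assms(4,5)]
  by (auto simp: gl_chain_iff gl_chain_map_def gl_boundary_def)

lemma gl_chain_map_cycle:
  assumes "omega_category C" and "omega_category D" and "dim_regular D"
    and "omega_functor C D f" and "non_1_contracting C D f"
    and "z \<in> gl_cycles C n"
  shows "gl_chain_map D f n z \<in> gl_cycles D n"
proof (cases n)
  case 0
  then show ?thesis
    using gl_chain_map_closed[OF assms(1,2,4)] assms(6) by simp
next
  case (Suc m)
  then show ?thesis
    using gl_chain_map_closed[OF assms(1,2,4)] gl_chain_map_boundary[OF assms(1-5), symmetric]
      assms(6)
    by (simp add: kernel_def)
qed

text \<open>The chain map preserves cycles and boundaries, hence passes to the quotient by
  \<open>the_elem_factor_map\<close>.\<close>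

lemma gl_induces_homology_map:
  assumes "omega_category C" and "omega_category D" and "dim_regular C" and "dim_regular D"
    and "omega_functor C D f" and "non_1_contracting C D f"
  shows "gl_induces C D f n (gl_homology_map C D f n)"
proof -
  note cycle = gl_chain_map_cycle[OF assms(1,2,4-6)]
  have "gl_chain_map D f n \<in> hom (gl_cycle_group C n) (gl_cycle_group D n)"
    by (rule homI) (simp_all add: gl_cycle_group_def cycle gl_chain_map_add)
  moreover have "gl_chain_map D f n ` gl_boundaries C n \<subseteq> gl_boundaries D n"
    using gl_chain_map_boundary[OF assms(1,2,4-6)] gl_chain_map_closed[OF assms(1,2,5)]
    by (auto simp: gl_boundaries_def)
  ultimately show ?thesis
    using cycle the_elem_factor_map[of "gl_cycle_group C n" "gl_cycle_group D n"
        "gl_boundaries C n" "gl_boundaries D n" "gl_chain_map D f n"]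
      group_gl_cycle_group[OF assms(3)] group_gl_cycle_group[OF assms(4)]
      normal_gl_boundaries[OF assms(1,3)] normal_gl_boundaries[OF assms(2,4)]
    by (simp add: gl_induces_def gl_homology_def gl_homology_map_def gl_class_def
        gl_cycle_group_def)
qed


section \<open>Homotopic functors\<close>

text \<open>Membership in \<open>hom\<close> gives additivity only on chains supported in
  \<open>S\<close>. Subtraction follows by applying it to \<open>(a - b) + b\<close>, once
  \<open>a - b\<close> is known to be supported there.\<close>

lemma hom_free_Abelian_group_diff:
  assumes "h \<in> hom (free_Abelian_group S) (free_Abelian_group T)"
    and "Poly_Mapping.keys a \<subseteq> S" and "Poly_Mapping.keys b \<subseteq> S"
  shows "h (a - b) = h a - h b"
proof -
  have "Poly_Mapping.keys (a - b) \<subseteq> S"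
    using keys_diff[of a b] assms(2,3) by blast
  then have "h ((a - b) + b) = h (a - b) + h b"
    using hom_mult[OF assms(1), of "a - b" b] assms(3) by simp
  then show ?thesis
    by simp
qed

lemma hom_free_Abelian_group_0:
  assumes "h \<in> hom (free_Abelian_group S) (free_Abelian_group T)"
  shows "h 0 = 0"
  using hom_free_Abelian_group_diff[OF assms, of 0 0] by simp

text \<open>Linear extension of the homotopy condition from cells to chains. As neither functor
  contracts 1-cells, the difference of images there is already the truncated one.\<close>

lemma homotopy_degree_1:
  assumes h: "h \<in> hom (cell_group C 1) (cell_group D 2)"
    and "non_1_contracting C D f" and "non_1_contracting C D g"
    and "\<And>x. x \<in> cells C 1 \<Longrightarrow> src_minus_tgt D 1 (h (frag_of x)) = frag_of (f x) - frag_of (g x)"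
    and "Poly_Mapping.keys c \<subseteq> cells C 1"
  shows "src_minus_tgt D 1 (h c) = frag_extend (trunc D 1 f) c - frag_extend (trunc D 1 g) c"
  using assms(5)
proof (induction c rule: cell_group_induct)
  case (frag_of x)
  then show ?case
    using assms(2-4) by (simp add: trunc_def non_1_contracting_def cells_def)
qed (simp_all add: hom_free_Abelian_group_0[OF h] hom_free_Abelian_group_diff[OF h]
    src_minus_tgt_diff frag_extend_diff)

lemma homotopy_degree_Suc:
  assumes "dim_regular C"
    and h: "h \<in> hom (cell_group C n) (cell_group D (Suc n))"
    and h': "h' \<in> hom (cell_group C (Suc n)) (cell_group D (Suc (Suc n)))"
    and "\<And>x. x \<in> cells C (Suc n) \<Longrightarrow>
      h (src_minus_tgt C n (frag_of x)) + src_minus_tgt D (Suc n) (h' (frag_of x))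
        = trunc D (Suc n) f x - trunc D (Suc n) g x"
    and "Poly_Mapping.keys c \<subseteq> cells C (Suc n)"
  shows "h (src_minus_tgt C n c) + src_minus_tgt D (Suc n) (h' c)
    = frag_extend (trunc D (Suc n) f) c - frag_extend (trunc D (Suc n) g) c"
  using assms(5)
proof (induction c rule: cell_group_induct)
  case (diff a b)
  \<comment> \<open>Splitting \<open>h\<close> requires its two arguments to be supported on
    \<open>n\<close>-cells, which is where \<open>dim_regular C\<close> enters.\<close>
  have "h (src_minus_tgt C n (a - b)) = h (src_minus_tgt C n a) - h (src_minus_tgt C n b)"
    using diff by (simp add: src_minus_tgt_diff hom_free_Abelian_group_diff[OF h]
        keys_src_minus_tgt[OF assms(1)])
  moreover have "src_minus_tgt D (Suc n) (h' (a - b))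
      = src_minus_tgt D (Suc n) (h' a) - src_minus_tgt D (Suc n) (h' b)"
    using diff by (simp add: src_minus_tgt_diff hom_free_Abelian_group_diff[OF h'])
  ultimately have "h (src_minus_tgt C n (a - b)) + src_minus_tgt D (Suc n) (h' (a - b))
      = (h (src_minus_tgt C n a) + src_minus_tgt D (Suc n) (h' a))
        - (h (src_minus_tgt C n b) + src_minus_tgt D (Suc n) (h' b))"
    by simp
  then show ?case
    unfolding diff.IH by (simp add: frag_extend_diff)
qed (simp_all add: assms(4) hom_free_Abelian_group_0[OF h] hom_free_Abelian_group_0[OF h'])

lemma gl_chain_map_homotopic:
  assumes "dim_regular C"
    and "non_1_contracting C D f" and "non_1_contracting C D g"
    and "gl_homotopic C D f g" and z: "z \<in> gl_cycles C n"
  shows "\<exists>b \<in> gl_boundaries D n. gl_chain_map D f n z = b + gl_chain_map D g n z"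
proof -
  obtain h where eq: "\<And>x. x \<in> cells C 0 \<Longrightarrow> f x = g x"
    and h: "\<And>n. n \<ge> 1 \<Longrightarrow> h n \<in> hom (cell_group C n) (cell_group D (n + 1))"
    and h1: "\<And>x. x \<in> cells C 1 \<Longrightarrow>
        src_minus_tgt D 1 (h 1 (frag_of x)) = frag_of (f x) - frag_of (g x)"
    and h2: "\<And>n x. \<lbrakk>n \<ge> 2; x \<in> cells C n\<rbrakk> \<Longrightarrow>
        h (n - 1) (src_minus_tgt C (n - 1) (frag_of x)) + src_minus_tgt D n (h n (frag_of x))
          = trunc D n f x - trunc D n g x"
    using assms(4) unfolding gl_homotopic_def by metis
  have zc: "z \<in> carrier (gl_chain C n)"
    using z gl_cycles_subset by blast
  show ?thesis
  proof (cases n)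
    case 0
    \<comment> \<open>The functors agree on 0-cells, so the required boundary is zero, written as
      the boundary of the zero chain.\<close>
    have "gl_boundary D 0 0 \<in> gl_boundaries D 0"
      unfolding gl_boundaries_def by (rule imageI) (simp add: gl_chain_iff)
    moreover have "linearize f c = linearize g c" if "Poly_Mapping.keys c \<subseteq> cells C 0" for c
      unfolding linearize_def using that eq by (auto intro!: frag_extend_eq)
    ultimately show ?thesis
      using zc 0 by (intro bexI[of _ "gl_boundary D 0 0"])
        (auto simp: gl_chain_iff gl_chain_map_def gl_boundary_def)
  next
    case (Suc m)
    have zk: "Poly_Mapping.keys (fst z) \<subseteq> cells C n"
      using zc by (simp add: gl_chain_iff)
    have d: "src_minus_tgt D n (h n (fst z))
        = frag_extend (trunc D n f) (fst z) - frag_extend (trunc D n g) (fst z)"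
    proof (cases "m = 0")
      \<comment> \<open>In degree 1 the homotopy has no lower term, so the identity holds for every
        chain and the cycle condition is not invoked.\<close>
      case True
      then show ?thesis
        using homotopy_degree_1[of "h 1" C D f g "fst z"] h[of 1] h1 assms(2,3) zk Suc
        by (simp add: numeral_2_eq_2)
    next
      case False
      \<comment> \<open>For \<open>m > 0\<close> this is exactly the cycle condition; it removes the
        lower term \<open>h m\<close> of the homotopy.\<close>
      have "src_minus_tgt C m (fst z) = 0"
        using z Suc False by (simp add: kernel_def gl_boundary_def zero_prod_def)
      moreover have "h m (src_minus_tgt C m (fst z)) + src_minus_tgt D (Suc m) (h (Suc m) (fst z))
          = frag_extend (trunc D (Suc m) f) (fst z) - frag_extend (trunc D (Suc m) g) (fst z)"
        using h[of m] h[of "Suc m"] h2[of "Suc m"] False zk Suc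
        by (intro homotopy_degree_Suc[OF assms(1)]) simp_all
      ultimately show ?thesis
        using hom_free_Abelian_group_0[OF h[of m]] False Suc by simp
    qed
    have "Poly_Mapping.keys (h n (fst z)) \<subseteq> cells D (Suc n)"
      using hom_in_carrier[OF h[of n], of "fst z"] zk Suc by simp
    \<comment> \<open>The witness is the boundary of the homotopy applied to the cycle; the second
      component is 0 because degree \<open>n + 1\<close> is positive.\<close>
    then have "gl_boundary D n (h n (fst z), 0) \<in> gl_boundaries D n"
      unfolding gl_boundaries_def by (intro imageI) (simp add: gl_chain_iff)
    then show ?thesis
      using d Suc by (intro bexI[of _ "gl_boundary D n (h n (fst z), 0)"])
        (simp_all add: gl_boundary_def gl_chain_map_def)
  qed
qed

lemma gl_class_eq:
  assumes "omega_category D" and "dim_regular D" and "y \<in> gl_cycles D n"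
    and "b \<in> gl_boundaries D n"
  shows "gl_class D n (b + y) = gl_class D n y"
proof -
  interpret G: group "gl_cycle_group D n"
    using group_gl_cycle_group[OF assms(2)] .
  interpret N: normal "gl_boundaries D n" "gl_cycle_group D n"
    using normal_gl_boundaries[OF assms(1,2)] .
  have "b + y \<in> gl_boundaries D n #>\<^bsub>gl_cycle_group D n\<^esub> y"
    using assms(4) by (auto simp: r_coset_def gl_cycle_group_def)
  then show ?thesis
    unfolding gl_class_def
    using G.repr_independence[OF _ _ N.is_subgroup] assms(3) by (simp add: gl_cycle_group_def)
qed

theorem theorem8p6:
  fixes C :: "'a omega_cat" and D :: "'b omega_cat" and f g :: "'a \<Rightarrow> 'b"
  assumes "omega_category C" and "omega_category D"
    and "dim_regular C" and "dim_regular D"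
    and "omega_functor C D f" and "non_1_contracting C D f"
    and "omega_functor C D g" and "non_1_contracting C D g"
    and "gl_homotopic C D f g"
  shows "\<forall>n. gl_induces C D f n (gl_homology_map C D f n) \<and>
             gl_induces C D g n (gl_homology_map C D g n) \<and>
             gl_homology_map C D f n = gl_homology_map C D g n"
proof
  fix n
  have F: "gl_induces C D f n (gl_homology_map C D f n)"
    and G: "gl_induces C D g n (gl_homology_map C D g n)"
    using assms by (auto intro: gl_induces_homology_map)
  \<comment> \<open>The maps are compared as total functions: on a homology class through a
    representing cycle, elsewhere because both are \<open>undefined\<close>.\<close>
  have "gl_homology_map C D f n X = gl_homology_map C D g n X" for X
  proof (cases "X \<in> carrier (gl_homology C n)")
    case True
    then obtain z where z: "z \<in> gl_cycles C n" "X = gl_class C n z"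
      by (auto simp: gl_homology_def carrier_FactGroup gl_class_def gl_cycle_group_def)
    obtain b where "b \<in> gl_boundaries D n" "gl_chain_map D f n z = b + gl_chain_map D g n z"
      using gl_chain_map_homotopic[OF assms(3,6,8,9) z(1)] by blast
    then have "gl_class D n (gl_chain_map D f n z) = gl_class D n (gl_chain_map D g n z)"
      using gl_class_eq[OF assms(2,4)] gl_chain_map_cycle[OF assms(1,2,4,7,8) z(1)] by simp
    then show ?thesis
      using F G z by (simp add: gl_induces_def)
  qed (simp add: gl_homology_map_def)
  then show "gl_induces C D f n (gl_homology_map C D f n) \<and>
      gl_induces C D g n (gl_homology_map C D g n) \<and>
      gl_homology_map C D f n = gl_homology_map C D g n"
    using F G by auto
qed

end
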